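(* Let $p=-X^4-Y^4-2X^2Y^2+4X^2\in\mathbb{R}[X,Y]$ and $\mathscr{S}(p)=\{z\in\mathbb{R}^2\mid p(z)\ge 0\}$. Then $\mathscr{L}(p)_2=\operatorname{conv}(\mathscr{S}(p))$ has a non-exposed face.
   Context: Let $\mathbb{R}[X,Y]_d$ be the space of real polynomials in $X,Y$ of degree at most $d$. For a single polynomial $p$ define $\mathrm{QM}(p)_d=\{\sigma_0+\sigma_1p\mid \sigma_0,\sigma_1\in\sum(\mathbb{R}[X,Y]_d)^2\}$, where $\sum(\mathbb{R}[X,Y]_d)^2$ is the set of finite sums of squares of elements of $\mathbb{R}[X,Y]_d$. The degree $d$ Lasserre relaxation is $\mathscr{L}(p)_d=\{z\in\mathbb{R}^2\mid \ell(z)\ge 0 \text{ for all } \ell\in \mathrm{QM}(p)_d\cap\mathbb{R}[X,Y]_1\}$. A face of a convex set $S$ is a nonempty convex subset $F\subseteq S$ such that whenever $\lambda x+(1-\lambda)y\in F$ for some $x,y\in S$, $\lambda\in(0,1)$, then $x,y\in F$. A face is exposed if it is of the form $\{x\in S\mid \ell(x)=0\}$ for some affine linear polynomial $\ell$ that is nonnegative on $S$. *)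

theory Defs
  imports "HOL-Analysis.Analysis" "HOL-Computational_Algebra.Polynomial"
begin

text \<open>
  \<open>\<real>[X,Y]\<close> is the iterated polynomial ring \<open>\<real>[X][Y]\<close>: the outer variable is \<open>Y\<close>, the
  inner one \<open>X\<close>, so the coefficient of \<open>X^i Y^j\<close> in \<open>p\<close> is \<open>coeff (coeff p j) i\<close>.
  The plane is \<^typ>\<open>real \<times> real\<close>.
\<close>

type_synonym bipoly = "real poly poly"

definition varX :: bipoly where
  "varX = [:[:0, 1:]:]"

definition varY :: bipoly where
  "varY = [:0, 1:]"

definition eval2 :: "bipoly \<Rightarrow> real \<times> real \<Rightarrow> real" where
  "eval2 p z = poly (poly p [:snd z:]) (fst z)"

text \<open>The degree is the total degree, not the \<^const>\<open>degree\<close> in \<open>Y\<close>.\<close>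

definition bipolys_upto :: "nat \<Rightarrow> bipoly set" where
  "bipolys_upto d = {p. \<forall>i j. coeff (coeff p j) i \<noteq> 0 \<longrightarrow> i + j \<le> d}"

definition sums_of_squares :: "'a::comm_semiring_1 set \<Rightarrow> 'a set" where
  "sums_of_squares A = {\<Sum>q\<leftarrow>qs. q\<^sup>2 | qs. set qs \<subseteq> A}"

text \<open>The degree bound is on the polynomials being squared: \<open>\<sigma>0\<close> and \<open>\<sigma>1\<close> may have
  degree up to \<open>2 * d\<close>, and \<open>\<sigma>1 * p\<close> is not truncated.\<close>

definition QM :: "bipoly \<Rightarrow> nat \<Rightarrow> bipoly set" where
  "QM p d = {\<sigma>0 + \<sigma>1 * p | \<sigma>0 \<sigma>1.
      \<sigma>0 \<in> sums_of_squares (bipolys_upto d) \<and> \<sigma>1 \<in> sums_of_squares (bipolys_upto d)}"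

definition Lasserre :: "bipoly \<Rightarrow> nat \<Rightarrow> (real \<times> real) set" where
  "Lasserre p d = {z. \<forall>l \<in> QM p d \<inter> bipolys_upto 1. eval2 l z \<ge> 0}"

definition nonneg_set :: "bipoly \<Rightarrow> (real \<times> real) set" where
  "nonneg_set p = {z. eval2 p z \<ge> 0}"

text \<open>Unlike \<^const>\<open>face_of\<close>, the present notion of face excludes the empty set.
  In \<^const>\<open>exposed_face_of\<close> the exposing affine function \<open>l(x) = b - a \<bullet> x\<close> may be
  identically zero, so a convex set is an exposed face of itself.\<close>

definition has_nonexposed_face :: "'a::euclidean_space set \<Rightarrow> bool" where
  "has_nonexposed_face S \<longleftrightarrow>
     (\<exists>F. F \<noteq> {} \<and> F face_of S \<and> \<not> F exposed_face_of S)"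

end

theory Submission
  imports Defs
begin

text \<open>
  Since \<open>p = (2X - X\<^sup>2 - Y\<^sup>2) (2X + X\<^sup>2 + Y\<^sup>2)\<close>, the set \<open>\<S>(p)\<close> is the union of the unit discs
  centred at \<open>(1, 0)\<close> and \<open>(-1, 0)\<close>, and its convex hull is a stadium. For \<open>c\<^sup>2 + s\<^sup>2 = 1\<close>, \<open>c \<ge> 0\<close> and
  \<open>k = 1 + c\<close>, the supporting line of the right disc with outer normal \<open>(c, s)\<close> has the certificate
  \<open>8k (k - cX - sY) = (X\<^sup>2 + Y\<^sup>2 - 2k)\<^sup>2 + 4c (X - k)\<^sup>2 + 4k (Y - s)\<^sup>2 + p\<close>,
  and \<open>X \<mapsto> -X\<close> gives the left disc, so every supporting line of the stadium comes from the
  quadratic module. The point \<open>(1, 1)\<close>, where the upper edge of the stadium meets the right arc,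
  is extreme but not exposed: the only supporting line there contains the whole edge.
\<close>

lemma eval2_add: "eval2 (p + q) z = eval2 p z + eval2 q z"
  by (simp add: eval2_def)

lemma eval2_mult: "eval2 (p * q) z = eval2 p z * eval2 q z"
  by (simp add: eval2_def)

lemma eval2_sos_nonneg:
  assumes "q \<in> sums_of_squares A"
  shows "eval2 q z \<ge> 0"
proof -
  have "eval2 (\<Sum>q\<leftarrow>qs. q\<^sup>2) z \<ge> 0" for qs
    by (induction qs) (simp_all add: eval2_def)
  then show ?thesis
    using assms by (auto simp: sums_of_squares_def)
qed

lemma nonneg_set_subset_Lasserre: "nonneg_set p \<subseteq> Lasserre p d"
proof -
  have "eval2 l z \<ge> 0" if "eval2 p z \<ge> 0" "l \<in> QM p d" for l z
    using that by (auto simp: QM_def eval2_add eval2_mult dest!: eval2_sos_nonneg[where z = z])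
  then show ?thesis
    by (auto simp: nonneg_set_def Lasserre_def)
qed

lemma bipolys_upto_1_eq:
  assumes "l \<in> bipolys_upto 1"
  obtains a b c where "l = [:[:a, b:], [:c:]:]"
proof
  show "l = [:[:coeff (coeff l 0) 0, coeff (coeff l 0) 1:], [:coeff (coeff l 1) 0:]:]"
    (is "l = ?r")
  proof (intro poly_eqI)
    fix j i
    show "coeff (coeff l j) i = coeff (coeff ?r j) i"
    proof (cases "i + j \<le> 1")
      case True
      then consider "i = 0" "j = 0" | "i = 1" "j = 0" | "i = 0" "j = 1"
        by linarith
      then show ?thesis
        by cases simp_all
    next
      case False
      then have "coeff (coeff l j) i = 0"
        using assms by (auto simp: bipolys_upto_def)
      with False show ?thesis
        by (auto simp: coeff_pCons split: nat.splits)
    qed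
  qed
qed

text \<open>The relaxation is an intersection of sets
  \<open>{z. (b, c) \<bullet> z \<ge> - a}\<close>, one for each linear member of the
  module.\<close>

lemma convex_Lasserre: "convex (Lasserre p d)"
proof -
  have "convex {z. eval2 l z \<ge> 0}" if l: "l \<in> bipolys_upto 1" for l
  proof -
    obtain a b c where "l = [:[:a, b:], [:c:]:]"
      using l by (rule bipolys_upto_1_eq)
    then have "{z. eval2 l z \<ge> 0} = {z. (b, c) \<bullet> z \<ge> - a}"
      by (auto simp: eval2_def algebra_simps)
    then show ?thesis
      by (simp add: convex_halfspace_ge)
  qed
  moreover have "Lasserre p d = (\<Inter>l \<in> QM p d \<inter> bipolys_upto 1. {z. eval2 l z \<ge> 0})"
    by (auto simp: Lasserre_def)
  ultimately show ?thesis
    by (auto intro: convex_INT)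
qed

definition two_discs_poly :: bipoly where
  "two_discs_poly = - (varX ^ 4) - varY ^ 4 - 2 * varX ^ 2 * varY ^ 2 + 4 * varX ^ 2"

text \<open>The square \<open>[-1, 1] \<times> [-1, 1]\<close> together with both unit discs;
  \<open>\<bar>x\<bar>\<close> folds the two discs into one inequality.\<close>

definition stadium :: "(real \<times> real) set" where
  "stadium = {(x, y). \<bar>y\<bar> \<le> 1 \<and> (\<bar>x\<bar> \<le> 1 \<or> (\<bar>x\<bar> - 1)\<^sup>2 + y\<^sup>2 \<le> 1)}"

lemma nonneg_set_two_discs:
  "nonneg_set two_discs_poly = {(x, y). (\<bar>x\<bar> - 1)\<^sup>2 + y\<^sup>2 \<le> 1}"
proof -
  have "eval2 two_discs_poly (x, y) \<ge> 0 \<longleftrightarrow> (\<bar>x\<bar> - 1)\<^sup>2 + y\<^sup>2 \<le> 1" for x y :: real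
  proof -
    have "eval2 two_discs_poly (x, y) = (2 * x)\<^sup>2 - (x\<^sup>2 + y\<^sup>2)\<^sup>2"
      by (simp add: two_discs_poly_def eval2_def varX_def varY_def power2_eq_square
          power4_eq_xxxx algebra_simps)
    then have "eval2 two_discs_poly (x, y) \<ge> 0 \<longleftrightarrow> (x\<^sup>2 + y\<^sup>2)\<^sup>2 \<le> (2 * \<bar>x\<bar>)\<^sup>2"
      by (simp add: power_mult_distrib)
    also have "\<dots> \<longleftrightarrow> x\<^sup>2 + y\<^sup>2 \<le> 2 * \<bar>x\<bar>"
      by (subst abs_le_square_iff[symmetric]) simp
    also have "\<dots> \<longleftrightarrow> (\<bar>x\<bar> - 1)\<^sup>2 + y\<^sup>2 \<le> 1"
      by (auto simp: power2_diff)
    finally show ?thesis .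
  qed
  then show ?thesis
    by (auto simp: nonneg_set_def)
qed

text \<open>The sign \<open>e\<close> selects the disc centred at \<open>(e, 0)\<close>, so the
  reflected case needs no second identity. The roots \<open>sqrt c\<close> and \<open>sqrt k\<close>
  move the weights \<open>4 * c\<close> and \<open>4 * k\<close> inside the squares.\<close>

lemma supporting_line_identity:
  fixes c s e :: real
  assumes cs: "c\<^sup>2 + s\<^sup>2 = 1" and c: "c \<ge> 0" and e: "e\<^sup>2 = 1"
  defines "k \<equiv> 1 + c"
  shows "[:[:8 * k * k, - 8 * k * c * e:], [:- 8 * k * s:]:] =
    [:[:- 2 * k, 0, 1:], 0, 1:]\<^sup>2 + [:[:- 2 * sqrt c * k, 2 * sqrt c * e:]:]\<^sup>2
      + [:[:- 2 * sqrt k * s:], [:2 * sqrt k:]:]\<^sup>2 + two_discs_poly"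
proof -
  have k: "sqrt k * sqrt k = k" "sqrt c * sqrt c = c"
    using c by (simp_all add: k_def)
  \<comment> \<open>Products get nested to the right during normalization, so each relation for a
    square is also given with a trailing factor \<open>u\<close>.\<close>
  have k': "sqrt k * (sqrt k * u) = k * u" "sqrt c * (sqrt c * u) = c * u" for u
    using k by (simp_all flip: mult.assoc)
  have s: "s * s = 1 - c * c" and e: "e * e = 1"
    using cs e by (simp_all add: power2_eq_square)
  have s': "s * (s * u) = (1 - c * c) * u" and e': "e * (e * u) = u" for u
    using s e by (simp_all flip: mult.assoc)
  show ?thesis
    by (simp add: two_discs_poly_def varX_def varY_def power2_eq_square power4_eq_xxxx
        numeral_poly one_pCons k k' s s' e e' algebra_simps)
      (simp add: k_def algebra_simps)
qed

text \<open>The squared polynomials have degree at most 2 and the multiplier of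
  \<open>two_discs_poly\<close> is 1, so order 2 suffices.\<close>

lemma supporting_line_in_QM:
  fixes c s e :: real
  assumes cs: "c\<^sup>2 + s\<^sup>2 = 1" and c: "c \<ge> 0" and e: "e\<^sup>2 = 1"
  defines "k \<equiv> 1 + c"
  shows "[:[:8 * k * k, - 8 * k * c * e:], [:- 8 * k * s:]:] \<in> QM two_discs_poly 2 \<inter> bipolys_upto 1"
proof
  let ?qs = "[[:[:- 2 * k, 0, 1:], 0, 1:], [:[:- 2 * sqrt c * k, 2 * sqrt c * e:]:],
      [:[:- 2 * sqrt k * s:], [:2 * sqrt k:]:]]"
  have "set ?qs \<subseteq> bipolys_upto 2"
    by (auto simp: bipolys_upto_def coeff_pCons split: nat.splits if_splits)
  then have "(\<Sum>q\<leftarrow>?qs. q\<^sup>2) \<in> sums_of_squares (bipolys_upto 2)"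
    unfolding sums_of_squares_def by blast
  moreover have "1 \<in> bipolys_upto 2"
    by (auto simp: bipolys_upto_def one_pCons coeff_pCons split: nat.splits)
  then have "1 \<in> sums_of_squares (bipolys_upto 2)"
    unfolding sums_of_squares_def by (intro CollectI exI[of _ "[1]"]) simp
  moreover have "[:[:8 * k * k, - 8 * k * c * e:], [:- 8 * k * s:]:]
      = (\<Sum>q\<leftarrow>?qs. q\<^sup>2) + 1 * two_discs_poly"
    using supporting_line_identity[OF cs c e] by (simp add: k_def add.assoc)
  ultimately show "[:[:8 * k * k, - 8 * k * c * e:], [:- 8 * k * s:]:] \<in> QM two_discs_poly 2"
    unfolding QM_def by blast
  show "[:[:8 * k * k, - 8 * k * c * e:], [:- 8 * k * s:]:] \<in> bipolys_upto 1"
    by (auto simp: bipolys_upto_def coeff_pCons split: nat.splits if_splits)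
qed

text \<open>The certified polynomial is \<open>8 * (1 + c)\<close> times the tangent inequality, and
  this factor is positive.\<close>

lemma Lasserre_supporting_line:
  fixes c s e :: real
  assumes "c\<^sup>2 + s\<^sup>2 = 1" "c \<ge> 0" "e\<^sup>2 = 1" "(x, y) \<in> Lasserre two_discs_poly 2"
  shows "c * e * x + s * y \<le> 1 + c"
proof -
  have "eval2 [:[:8 * (1 + c) * (1 + c), - 8 * (1 + c) * c * e:], [:- 8 * (1 + c) * s:]:] (x, y) \<ge> 0"
    using assms supporting_line_in_QM[of c s e] unfolding Lasserre_def by blast
  then have "0 \<le> 8 * (1 + c) * (1 + c - (c * e * x + s * y))"
    by (simp add: eval2_def algebra_simps)
  then show ?thesis
    using assms(2) by (simp add: zero_le_mult_iff)
qed

lemma Lasserre_subset_stadium: "Lasserre two_discs_poly 2 \<subseteq> stadium"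
proof
  fix z
  assume "z \<in> Lasserre two_discs_poly 2"
  then obtain x y where z: "z = (x, y)" and L: "(x, y) \<in> Lasserre two_discs_poly 2"
    by (cases z) auto
  \<comment> \<open>The normals \<open>(0, 1)\<close> and \<open>(0, -1)\<close> give the two
    straight edges.\<close>
  have y: "\<bar>y\<bar> \<le> 1"
    using Lasserre_supporting_line[of 0 1 1, OF _ _ _ L]
      Lasserre_supporting_line[of 0 "-1" 1, OF _ _ _ L] by simp
  have "(\<bar>x\<bar> - 1)\<^sup>2 + y\<^sup>2 \<le> 1" if x: "\<bar>x\<bar> > 1"
  proof -
    \<comment> \<open>The distance from \<open>(x, y)\<close> to the nearer centre
      \<open>(sgn x, 0)\<close>. The tangent used has the unit vector from that centre towards
      \<open>(x, y)\<close> as its normal.\<close>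
    define r where "r = sqrt ((\<bar>x\<bar> - 1)\<^sup>2 + y\<^sup>2)"
    have r2: "r\<^sup>2 = (\<bar>x\<bar> - 1)\<^sup>2 + y\<^sup>2"
      by (simp add: r_def)
    have r: "r > 0"
      using x unfolding r_def by (intro real_sqrt_gt_zero add_pos_nonneg zero_less_power) simp_all
    have "((\<bar>x\<bar> - 1) / r)\<^sup>2 + (y / r)\<^sup>2 = r\<^sup>2 / r\<^sup>2"
      by (simp only: r2 power_divide add_divide_distrib)
    then have "((\<bar>x\<bar> - 1) / r)\<^sup>2 + (y / r)\<^sup>2 = 1"
      using r by simp
    moreover have "(sgn x)\<^sup>2 = 1"
      using x by (auto simp: sgn_if)
    ultimately have "(\<bar>x\<bar> - 1) / r * sgn x * x + y / r * y \<le> 1 + (\<bar>x\<bar> - 1) / r"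
      using x r by (intro Lasserre_supporting_line L) auto
    moreover have "(\<bar>x\<bar> - 1) / r * sgn x * x + y / r * y = ((\<bar>x\<bar> - 1) * \<bar>x\<bar> + y * y) / r"
      by (simp add: sgn_if add_divide_distrib)
    ultimately have "((\<bar>x\<bar> - 1) * \<bar>x\<bar> + y * y) / r \<le> 1 + (\<bar>x\<bar> - 1) / r"
      by simp
    then have "(\<bar>x\<bar> - 1) * \<bar>x\<bar> + y * y \<le> (1 + (\<bar>x\<bar> - 1) / r) * r"
      using r by (simp only: pos_divide_le_eq)
    also have "\<dots> = r + (\<bar>x\<bar> - 1)"
      using r by (simp add: distrib_right)
    finally have "(\<bar>x\<bar> - 1) * \<bar>x\<bar> + y * y \<le> r + (\<bar>x\<bar> - 1)" .
    \<comment> \<open>The left side above is \<open>r * r + (\<bar>x\<bar> - 1)\<close>.\<close>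
    then have "r * r \<le> r * 1"
      using r2 by (simp add: power2_eq_square algebra_simps)
    then have "r \<le> 1"
      using r by (simp only: mult_le_cancel_left_pos)
    then show ?thesis
      using r r2 power_le_one[of r 2] by simp
  qed
  with y show "z \<in> stadium"
    by (cases "\<bar>x\<bar> \<le> 1") (simp_all add: stadium_def z)
qed

text \<open>A point with \<open>\<bar>x\<bar> \<le> 1\<close> lies on a horizontal segment joining
  the vertical diameters of the two discs.\<close>

lemma stadium_subset_hull: "stadium \<subseteq> convex hull (nonneg_set two_discs_poly)"
proof
  fix z
  assume "z \<in> stadium"
  then obtain x y where z: "z = (x, y)" and y: "\<bar>y\<bar> \<le> 1"
    and xy: "\<bar>x\<bar> \<le> 1 \<or> (\<bar>x\<bar> - 1)\<^sup>2 + y\<^sup>2 \<le> 1"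
    by (auto simp: stadium_def)
  show "z \<in> convex hull (nonneg_set two_discs_poly)"
  proof (cases "\<bar>x\<bar> \<le> 1")
    case True
    have "y\<^sup>2 \<le> 1"
      using y by (simp add: abs_square_le_1)
    then have "(1, y) \<in> convex hull (nonneg_set two_discs_poly)"
      "(- 1, y) \<in> convex hull (nonneg_set two_discs_poly)"
      by (auto simp: nonneg_set_two_discs intro: hull_inc)
    moreover have "z = ((1 + x) / 2) *\<^sub>R (1, y) + ((1 - x) / 2) *\<^sub>R (- 1, y)"
      by (simp add: z field_simps)
    ultimately show ?thesis
      using True by (simp only:) (rule convexD[OF convex_convex_hull], simp_all add: field_simps)
  next
    case False
    with xy have "z \<in> nonneg_set two_discs_poly"
      by (simp add: z nonneg_set_two_discs)
    then show ?thesis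
      by (rule hull_inc)
  qed
qed

text \<open>The hull lies in the relaxation, the relaxation in the stadium and the stadium in the
  hull, so all three agree.\<close>

lemma Lasserre_two_discs: "Lasserre two_discs_poly 2 = stadium"
  and convex_hull_two_discs: "convex hull (nonneg_set two_discs_poly) = stadium"
  using Lasserre_subset_stadium stadium_subset_hull
    hull_minimal[where S = convex, OF nonneg_set_subset_Lasserre convex_Lasserre, of two_discs_poly 2]
  by blast+

text \<open>\<open>(1, 1)\<close> maximizes \<open>y\<close> on the stadium and then
  \<open>x\<close> on the edge \<open>y = 1\<close>, so both ends of a segment through it attain
  these maxima.\<close>

lemma extreme_point_of_stadium: "(1, 1) extreme_point_of stadium"
  unfolding extreme_point_of_def
proof (intro conjI ballI notI)
  show "(1, 1) \<in> stadium"
    by (simp add: stadium_def)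
  fix a b
  assume a: "a \<in> stadium" and b: "b \<in> stadium" and ab: "(1, 1) \<in> open_segment a b"
  obtain a1 a2 b1 b2 where ab_eq: "a = (a1, a2)" "b = (b1, b2)"
    by (cases a, cases b)
  obtain u where u: "0 < u" "u < 1" and "(1, 1) = (1 - u) *\<^sub>R a + u *\<^sub>R b" and "a \<noteq> b"
    using ab by (auto simp: in_segment)
  then have u1: "1 = (1 - u) * a1 + u * b1" and u2: "1 = (1 - u) * a2 + u * b2"
    by (simp_all add: ab_eq)
  have extremal: "v = 1 \<and> w = 1"
    if "v \<le> 1" "w \<le> 1" "1 = (1 - u) * v + u * w" for v w :: real
  proof -
    have "(1 - u) * (1 - v) + u * (1 - w) = 0"
      using that by (simp add: algebra_simps)
    moreover have "(1 - u) * (1 - v) \<ge> 0" "u * (1 - w) \<ge> 0"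
      using that u by simp_all
    ultimately have "(1 - u) * (1 - v) = 0" "u * (1 - w) = 0"
      by linarith+
    then show ?thesis
      using u by simp
  qed
  have "a2 \<le> 1" "b2 \<le> 1"
    using a b by (auto simp: stadium_def ab_eq)
  with u2 have 2: "a2 = 1 \<and> b2 = 1"
    by (intro extremal)
  then have "a1 \<le> 1" "b1 \<le> 1"
    using a b by (auto simp: stadium_def ab_eq)
  with u1 have "a1 = 1 \<and> b1 = 1"
    by (intro extremal)
  with 2 \<open>a \<noteq> b\<close> show False
    by (simp add: ab_eq)
qed

lemma not_exposed_stadium: "\<not> {(1, 1)} exposed_face_of stadium"
proof
  assume "{(1, 1)} exposed_face_of stadium"
  then obtain a b where sub: "stadium \<subseteq> {x. a \<bullet> x \<le> b}"
    and eq: "{(1, 1)} = stadium \<inter> {x. a \<bullet> x = b}"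
    by (auto simp: exposed_face_of_def)
  obtain a1 a2 where a: "a = (a1, a2)"
    by (cases a)
  have b: "b = a1 + a2"
  proof -
    have "(1, 1) \<in> stadium \<inter> {x. a \<bullet> x = b}"
      using eq by blast
    then show ?thesis
      by (simp add: a)
  qed
  \<comment> \<open>The other end of the upper edge forces \<open>a1 \<ge> 0\<close>, and
    \<open>a1 = 0\<close> would put it into the exposed face.\<close>
  have left: "(- 1, 1) \<in> stadium"
    by (simp add: stadium_def)
  then have "a1 \<ge> 0"
    using sub by (auto simp: a b)
  moreover have "a1 \<noteq> 0"
  proof
    assume "a1 = 0"
    with left have "(- 1, 1) \<in> stadium \<inter> {x. a \<bullet> x = b}"
      by (simp add: a b)
    then show False
      by (simp flip: eq)
  qed
  ultimately have a1: "a1 > 0"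
    by simp
  define r where "r = sqrt (a1\<^sup>2 + a2\<^sup>2)"
  have r2: "r\<^sup>2 = a1\<^sup>2 + a2\<^sup>2"
    by (simp add: r_def)
  have "\<bar>a2\<bar> < r"
    unfolding r_def using a1 by (intro real_less_rsqrt) simp
  then have r: "r > 0" and a2: "a2 < r"
    by simp_all
  \<comment> \<open>This point maximizes the functional \<open>a\<close> over the right disc, with
    value \<open>a1 + r\<close>, which exceeds the supposed maximum \<open>a1 + a2\<close>.\<close>
  have "(1 + a1 / r, a2 / r) \<in> stadium"
    using a1 r \<open>\<bar>a2\<bar> < r\<close> r2
    by (simp add: stadium_def power_divide flip: add_divide_distrib)
  then have "a1 * (1 + a1 / r) + a2 * (a2 / r) \<le> a1 + a2"
    using sub by (auto simp: a b)
  then have "r * r \<le> a2 * r"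
    using r r2 by (simp add: field_simps power2_eq_square)
  with a2 r show False
    by simp
qed

theorem corollary4p14:
  fixes p :: bipoly
  assumes "p = - (varX ^ 4) - varY ^ 4 - 2 * varX ^ 2 * varY ^ 2 + 4 * varX ^ 2"
  shows "Lasserre p 2 = convex hull (nonneg_set p) \<and> has_nonexposed_face (Lasserre p 2)"
proof -
  have p: "p = two_discs_poly"
    using assms by (simp add: two_discs_poly_def)
  have "{(1, 1)} face_of stadium"
    using extreme_point_of_stadium by (simp add: face_of_singleton)
  then show ?thesis
    using not_exposed_stadium
    by (auto simp: p Lasserre_two_discs convex_hull_two_discs has_nonexposed_face_def)
qed

end
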